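(* Let $A=T[a_0,\ldots,a_{n-1}]$ be an $n\times n$ real symmetric Toeplitz matrix, and let $C_1,\ldots,C_k$ be the components of its weighted Toeplitz graph $G(A)$, indexed so that $M(C_1)<M(C_2)<\cdots<M(C_k)$, where $M(C_i)=\max\{v: v\in V(C_i)\}$. Then \[C_1\lesssim C_2\lesssim\cdots\lesssim C_k,\] where $G\lesssim H$ means that $G$ is isomorphic (as an edge-weighted graph) to an induced subgraph of $H$.
   Context: $[n]=\{1,\ldots,n\}$. For real numbers $a_0,\ldots,a_{n-1}$, $T[a_0,\ldots,a_{n-1}]$ denotes the $n\times n$ symmetric Toeplitz matrix whose $(i,j)$ entry is $a_{|i-j|}$. Let $S_A=\{i\in\{0,\ldots,n-1\} : a_i\neq 0\}$. The weighted Toeplitz graph $G(A)$ is the edge-weighted graph with vertex set $[n]$, edge set $\{ij: i,j\in[n],\ |i-j|\in S_A\}$, and weight $w(ij)=a_{|i-j|}$. A component is a maximal connected subgraph. *)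

theory Defs
  imports
    "Jordan_Normal_Form.Matrix"
    "Graph_Theory.Graph_Theory"
begin

definition toeplitz_mat :: "nat \<Rightarrow> (nat \<Rightarrow> real) \<Rightarrow> real mat" where
  "toeplitz_mat n a = mat n n (\<lambda>(i, j). a (nat \<bar>int i - int j\<bar>))"

text \<open>
  A Toeplitz matrix determines its parameters \<open>a\<^sub>0, \<dots>, a\<^sub>n\<^sub>-\<^sub>1\<close>: they form its first row.
\<close>

definition toeplitz_param :: "real mat \<Rightarrow> nat \<Rightarrow> real" where
  "toeplitz_param A d = A $$ (0, d)"

definition toeplitz_support :: "real mat \<Rightarrow> nat set" where
  "toeplitz_support A = {d. d < dim_col A \<and> toeplitz_param A d \<noteq> 0}"

text \<open>
  Following the convention of the graph library, an undirected graph is a symmetric digraph: an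
  edge \<open>ij\<close> with \<open>i \<noteq> j\<close> is the pair of arcs \<open>(i, j)\<close> and \<open>(j, i)\<close>, both of weight \<open>w(ij)\<close>. If
  \<open>a\<^sub>0 \<noteq> 0\<close>, every vertex carries a loop of weight \<open>a\<^sub>0\<close>. Vertices are numbered from 1, whereas
  matrix indices start at 0; only differences of indices matter.
\<close>

definition toeplitz_graph :: "real mat \<Rightarrow> (nat, nat \<times> nat) pre_digraph" where
  "toeplitz_graph A =
    \<lparr> verts = {1..dim_row A},
      arcs = {(i, j). i \<in> {1..dim_row A} \<and> j \<in> {1..dim_row A} \<and>
                      nat \<bar>int i - int j\<bar> \<in> toeplitz_support A},
      tail = fst, head = snd \<rparr>"

definition toeplitz_weight :: "real mat \<Rightarrow> (nat \<times> nat) weight_fun" where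
  "toeplitz_weight A = (\<lambda>(i, j). toeplitz_param A (nat \<bar>int i - int j\<bar>))"

text \<open>
  The qualified name is needed because \<open>connected\<close> is also a topological notion. The library's
  notion excludes the null graph.
\<close>

definition graph_components :: "('a, 'b) pre_digraph \<Rightarrow> ('a, 'b) pre_digraph set" where
  "graph_components G = {H. pre_digraph.max_subgraph G Digraph_Component.connected H}"

definition weighted_iso ::
    "('a, 'b) pre_digraph \<Rightarrow> 'b weight_fun \<Rightarrow> ('c, 'd) pre_digraph \<Rightarrow> 'd weight_fun \<Rightarrow> bool" where
  "weighted_iso G w H w' \<longleftrightarrow>
    (\<exists>f. pre_digraph.digraph_isomorphism G f \<and> H = app_iso f G \<and>
         (\<forall>e \<in> arcs G. w' (iso_arcs f e) = w e))"

definition weighted_induced_embeds ::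
    "('a, 'b) pre_digraph \<Rightarrow> 'b weight_fun \<Rightarrow> ('c, 'd) pre_digraph \<Rightarrow> 'd weight_fun \<Rightarrow> bool" where
  "weighted_induced_embeds G w H w' \<longleftrightarrow>
    (\<exists>H'. induced_subgraph H' H \<and> weighted_iso G w H' w')"

lemma toeplitz_param_toeplitz_mat:
  "d < n \<Longrightarrow> toeplitz_param (toeplitz_mat n a) d = a d"
  by (simp add: toeplitz_param_def toeplitz_mat_def)

lemma toeplitz_support_toeplitz_mat:
  "toeplitz_support (toeplitz_mat n a) = {d. d < n \<and> a d \<noteq> 0}"
  by (auto simp: toeplitz_support_def toeplitz_param_def toeplitz_mat_def)

lemma pseudo_graph_toeplitz_graph: "pseudo_graph (toeplitz_graph A)"
proof
  show "finite (arcs (toeplitz_graph A))"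
    by (rule finite_subset[of _ "{1..dim_row A} \<times> {1..dim_row A}"])
       (auto simp: toeplitz_graph_def)
  show "symmetric (toeplitz_graph A)"
    by (auto simp: symmetric_def sym_def arcs_ends_def arc_to_ends_def toeplitz_graph_def
        abs_minus_commute)
qed (auto simp: toeplitz_graph_def)

lemma toeplitz_weight_commute: "toeplitz_weight A (i, j) = toeplitz_weight A (j, i)"
  by (simp add: toeplitz_weight_def abs_minus_commute)

end

theory Submission
  imports Defs
begin

text \<open>
  Translation by \<open>t = M(C\<^sub>i\<^sub>+\<^sub>1) - M(C\<^sub>i)\<close> keeps \<open>C\<^sub>i\<close> inside \<open>[n]\<close> and preserves all differences of
  vertices, hence edges, non-edges and weights. The translate is therefore a connected induced
  subgraph of \<open>G(A)\<close>. It contains the vertex \<open>M(C\<^sub>i\<^sub>+\<^sub>1)\<close>, so it lies inside \<open>C\<^sub>i\<^sub>+\<^sub>1\<close>.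
\<close>

lemma strongly_connected_imp_connected:
  assumes "wf_digraph H" "strongly_connected H"
  shows "Digraph_Component.connected H"
  using assms unfolding Digraph_Component.connected_def strongly_connected_def
  by (auto intro: wf_digraph.reachable_mk_symmetricI)

text \<open>Adding arcs on a fixed vertex set cannot destroy connectedness. A maximal connected
  subgraph therefore contains every arc between its vertices, that is, it is induced.\<close>

lemma arc_mono_connected: "arc_mono Digraph_Component.connected"
  unfolding arc_mono_def
proof (intro allI impI)
  fix H1 H2 :: "('a, 'b) pre_digraph"
  assume "Digraph_Component.connected H1 \<and> subgraph H1 H2 \<and> verts H1 = verts H2"
  then show "Digraph_Component.connected H2"
    by (intro wf_digraph.connected_spanning_imp_connected[of H2 H1])
       (auto simp: spanning_def)
qed

text \<open>A component is induced, so it inherits the symmetry of the graph, and a connected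
  symmetric digraph is strongly connected. This gives access to the library's facts about
  \<open>sccs\<close>.\<close>

lemma (in sym_digraph) graph_components_subset_sccs: "graph_components G \<subseteq> sccs"
proof
  fix H
  assume "H \<in> graph_components G"
  then have H: "max_subgraph Digraph_Component.connected H"
    by (simp add: graph_components_def)
  then have ind: "induced_subgraph H G"
    by (rule induced_subgraphI_arc_mono[OF _ arc_mono_connected])
  interpret H: sym_digraph H
    using ind by (rule induced_graph_imp_graph)
  have "strongly_connected H"
    using H.sym_arcs max_subgraph_prop[OF H] by (rule H.symmetric_connected_imp_strongly_connected)
  \<comment> \<open>Maximality passes to the narrower property: a larger strongly connected subgraph
    would also be a larger connected one.\<close>
  then have "max_subgraph strongly_connected H"
    using H by (auto simp: max_subgraph_def intro: strongly_connected_imp_connected)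
  then show "H \<in> sccs"
    by (simp add: sccs_altdef2)
qed

text \<open>Every vertex of \<open>K\<close> and the shared vertex \<open>u\<close> reach each other
  in \<open>K\<close>, hence in \<open>G\<close>, and the vertex set of a strongly connected
  component is closed under mutual reachability.\<close>

lemma (in wf_digraph) strongly_connected_subset_scc:
  assumes H: "H \<in> sccs"
    and K: "subgraph K G" "strongly_connected K"
    and u: "u \<in> verts H" "u \<in> verts K"
  shows "verts K \<subseteq> verts H"
proof
  fix v
  assume "v \<in> verts K"
  with K u have "u \<rightarrow>\<^sup>* v" "v \<rightarrow>\<^sup>* u"
    by (auto simp: strongly_connected_def intro: reachable_mono)
  moreover have "verts H \<in> sccs_verts"
    using H by (intro in_sccs_vertsI_sccs imageI)
  ultimately show "v \<in> verts H"
    using u by (auto simp: sccs_verts_def)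
qed

lemma induced_subgraph_verts_subset:
  assumes "induced_subgraph K G" "induced_subgraph H G" "verts K \<subseteq> verts H"
  shows "induced_subgraph K H"
  using assms by (auto simp: induced_subgraph_def subgraph_def compatible_def)

text \<open>The isomorphism record also fixes the incidence maps of the image graph. Here they are
  those of \<open>toeplitz_graph\<close>, so that a translate can again be a subgraph of it.\<close>

definition translation :: "nat \<Rightarrow> (nat, nat \<times> nat, nat, nat \<times> nat) digraph_isomorphism" where
  "translation t =
    \<lparr> iso_verts = (\<lambda>v. v + t), iso_arcs = map_prod (\<lambda>v. v + t) (\<lambda>v. v + t),
      iso_head = snd, iso_tail = fst \<rparr>"

lemma translation_simps [simp]:
  "iso_verts (translation t) = (\<lambda>v. v + t)"
  "iso_arcs (translation t) = map_prod (\<lambda>v. v + t) (\<lambda>v. v + t)"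
  "iso_head (translation t) = snd"
  "iso_tail (translation t) = fst"
  by (simp_all add: translation_def)

lemma toeplitz_graph_simps:
  "verts (toeplitz_graph A) = {1..dim_row A}"
  "(i, j) \<in> arcs (toeplitz_graph A) \<longleftrightarrow>
    i \<in> {1..dim_row A} \<and> j \<in> {1..dim_row A} \<and> nat \<bar>int i - int j\<bar> \<in> toeplitz_support A"
  "tail (toeplitz_graph A) = fst"
  "head (toeplitz_graph A) = snd"
  by (simp_all add: toeplitz_graph_def)

lemma digraph_isomorphism_translation:
  assumes "subgraph H (toeplitz_graph A)"
  shows "pre_digraph.digraph_isomorphism H (translation t)"
  using assms
  by (auto simp: pre_digraph.digraph_isomorphism_def subgraph_def compatible_def
      toeplitz_graph_simps inj_on_def)

lemma toeplitz_weight_translation: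
  "toeplitz_weight A (iso_arcs (translation t) e) = toeplitz_weight A e"
  by (cases e) (simp add: toeplitz_weight_def)

text \<open>Whether a pair in range is an arc depends only on the difference of its ends. Since
  \<open>t\<close> is a natural number, a translate can leave the range only at the top, which
  \<open>le\<close> rules out.\<close>

lemma induced_subgraph_translation:
  assumes H: "induced_subgraph H (toeplitz_graph A)"
    and le: "\<And>v. v \<in> verts H \<Longrightarrow> v + t \<le> dim_row A"
  shows "induced_subgraph (app_iso (translation t) H) (toeplitz_graph A)"
proof -
  interpret G: pseudo_graph "toeplitz_graph A"
    by (rule pseudo_graph_toeplitz_graph)
  have verts: "verts H \<subseteq> {1..dim_row A}"
    using H by (auto simp: induced_subgraph_def subgraph_def toeplitz_graph_simps)
  have arcs: "(i, j) \<in> arcs H \<longleftrightarrow>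
      i \<in> verts H \<and> j \<in> verts H \<and> nat \<bar>int i - int j\<bar> \<in> toeplitz_support A" for i j
    using H verts by (auto simp: induced_subgraph_def toeplitz_graph_simps)
  let ?V = "(\<lambda>v. v + t) ` verts H"
  have sub: "?V \<subseteq> verts (toeplitz_graph A)"
    using verts le by (force simp: toeplitz_graph_simps)
  \<comment> \<open>The inclusion from right to left is where non-edges are preserved: an arc
    between translated vertices comes from an arc of \<open>H\<close>, because \<open>H\<close> is
    induced.\<close>
  have "arcs (app_iso (translation t) H) = arcs (toeplitz_graph A \<restriction> ?V)"
  proof (intro equalityI subsetI)
    fix e
    assume "e \<in> arcs (app_iso (translation t) H)"
    then obtain i j where "e = (i + t, j + t)" "(i, j) \<in> arcs H"
      by auto
    then show "e \<in> arcs (toeplitz_graph A \<restriction> ?V)"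
      using sub by (auto simp: arcs toeplitz_graph_simps)
  next
    fix e
    assume e: "e \<in> arcs (toeplitz_graph A \<restriction> ?V)"
    then obtain i j where ij: "e = (i + t, j + t)" "i \<in> verts H" "j \<in> verts H"
      by (cases e) (auto simp: toeplitz_graph_simps)
    with e have "(i, j) \<in> arcs H"
      by (simp add: arcs toeplitz_graph_simps)
    with ij show "e \<in> arcs (app_iso (translation t) H)"
      by (auto intro!: rev_image_eqI)
  qed
  then have "app_iso (translation t) H = toeplitz_graph A \<restriction> ?V"
    by (intro pre_digraph.equality) (simp_all add: toeplitz_graph_simps)
  with sub show ?thesis
    by (simp add: G.induced_induce)
qed

text \<open>The argument uses only the order of the two maxima, so the components need not be
  consecutive.\<close>

lemma toeplitz_component_embeds:
  assumes C: "C \<in> graph_components (toeplitz_graph A)"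
    and D: "D \<in> graph_components (toeplitz_graph A)"
    and le: "Max (verts C) \<le> Max (verts D)"
  shows "weighted_induced_embeds C (toeplitz_weight A) D (toeplitz_weight A)"
proof -
  interpret G: pseudo_graph "toeplitz_graph A"
    by (rule pseudo_graph_toeplitz_graph)
  have sccs: "C \<in> G.sccs" "D \<in> G.sccs"
    using C D G.graph_components_subset_sccs by auto
  then have ind: "induced_subgraph C (toeplitz_graph A)" "induced_subgraph D (toeplitz_graph A)"
    and sc: "strongly_connected C" "strongly_connected D"
    by (auto simp: G.sccs_def)
  have verts: "verts C \<subseteq> {1..dim_row A}" "verts D \<subseteq> {1..dim_row A}"
    using ind by (auto simp: induced_subgraph_def subgraph_def toeplitz_graph_simps)
  then have fin: "finite (verts C)" "finite (verts D)"
    by (auto intro: finite_subset)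
  have ne: "verts C \<noteq> {}" "verts D \<noteq> {}"
    using sc by (simp_all add: strongly_connected_def)
  \<comment> \<open>By \<open>le\<close> this natural subtraction does not truncate.\<close>
  define t where "t = Max (verts D) - Max (verts C)"
  let ?K = "app_iso (translation t) C"
  have Max_D: "Max (verts D) = Max (verts C) + t"
    using le by (simp add: t_def)
  have "Max (verts D) \<in> verts D"
    using fin ne by simp
  with verts have "Max (verts D) \<le> dim_row A"
    by auto
  moreover have "v + t \<le> Max (verts D)" if "v \<in> verts C" for v
    using that fin by (simp add: Max_D)
  ultimately have ind_K: "induced_subgraph ?K (toeplitz_graph A)"
    using ind by (intro induced_subgraph_translation) (auto intro: order_trans)
  have iso: "pre_digraph.digraph_isomorphism C (translation t)"
    using ind by (intro digraph_isomorphism_translation induced_imp_subgraph)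
  have "verts ?K \<subseteq> verts D"
  proof (rule G.strongly_connected_subset_scc[OF sccs(2)])
    show "subgraph ?K (toeplitz_graph A)"
      using ind_K by (rule induced_imp_subgraph)
    show "strongly_connected ?K"
      using iso sc by simp
    show "Max (verts D) \<in> verts D"
      by fact
    \<comment> \<open>The translate of \<open>Max (verts C)\<close> is the vertex that
      \<open>?K\<close> shares with \<open>D\<close>.\<close>
    show "Max (verts D) \<in> verts ?K"
      using fin ne by (simp add: Max_D)
  qed
  then have "induced_subgraph ?K D"
    by (rule induced_subgraph_verts_subset[OF ind_K ind(2)])
  moreover have "weighted_iso C (toeplitz_weight A) ?K (toeplitz_weight A)"
    using iso toeplitz_weight_translation unfolding weighted_iso_def by blast
  ultimately show ?thesis
    unfolding weighted_induced_embeds_def by blast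
qed

theorem theorem3p4:
  fixes n k :: nat
    and a :: "nat \<Rightarrow> real"
    and A :: "real mat"
    and C :: "nat \<Rightarrow> (nat, nat \<times> nat) pre_digraph"
  assumes "A = toeplitz_mat n a"
    and "bij_betw C {1..k} (graph_components (toeplitz_graph A))"
    and "\<And>i j. 1 \<le> i \<Longrightarrow> i < j \<Longrightarrow> j \<le> k \<Longrightarrow> Max (verts (C i)) < Max (verts (C j))"
  shows "\<forall>i \<in> {1..<k}.
    weighted_induced_embeds (C i) (toeplitz_weight A) (C (i + 1)) (toeplitz_weight A)"
proof
  fix i
  assume i: "i \<in> {1..<k}"
  show "weighted_induced_embeds (C i) (toeplitz_weight A) (C (i + 1)) (toeplitz_weight A)"
  proof (rule toeplitz_component_embeds)
    show "C i \<in> graph_components (toeplitz_graph A)"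
      "C (i + 1) \<in> graph_components (toeplitz_graph A)"
      using i by (auto intro!: bij_betw_apply[OF assms(2)])
    show "Max (verts (C i)) \<le> Max (verts (C (i + 1)))"
      using i assms(3)[of i "i + 1"] by simp
  qed
qed

end
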